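(* Let $\mathfrak M_0$ be the class of all separable metrizable spaces. Any Ascoli $\aleph_0$-space belongs to the class $\mathbf{C}_k[\mathfrak M_0]$.
   Context: All topological spaces are regular $T_1$-spaces. $C_k(X,Y)$ is the set of all continuous functions $X\to Y$ endowed with the compact-open topology, and $C_k(X)=C_k(X,\mathbb R)$. A class $\mathcal X$ of topological spaces is stable if it is closed under taking subspaces, homeomorphic images, countable topological sums and countable Tychonoff products. It is $C_k$-stable if it is stable and for any Lindelöf space $X\in\mathcal X$ and any space $Y\in\mathcal X$ the space $C_k(X,Y)$ belongs to $\mathcal X$. For a class $\mathcal X$, $\mathbf{C}_k[\mathcal X]$ denotes the smallest $C_k$-stable class containing $\mathcal X$. A family $\mathcal N$ of subsets of a space $X$ is a $k$-network if for any open $U\subset X$ and compact $K\subset U$ there is a finite subfamily $\mathcal F\subset\mathcal N$ with $K\subset\bigcup\mathcal F\subset U$. A (regular) space is an $\aleph_0$-space if it has a countable $k$-network. A subset $\mathcal K\subset C_k(X,Y)$ is evenly continuous if the map $(f,x)\mapsto f(x)$ is continuous as a map $\mathcal K\times X\to Y$. A space $X$ is Ascoli if each compact subset of $C_k(X)$ is evenly continuous. *)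

theory Defs
  imports "HOL-Analysis.Analysis"
begin

definition regular_T1_space :: "'a topology \<Rightarrow> bool" where
  "regular_T1_space X \<longleftrightarrow> regular_space X \<and> t1_space X"

text \<open>A continuous map between topologies on types is only determined on the topspace of its
  domain, so the points of \<open>C\<^sub>k(X,Y)\<close> are the continuous maps that are extensional there.\<close>

definition Ck_carrier :: "'a topology \<Rightarrow> 'b topology \<Rightarrow> ('a \<Rightarrow> 'b) set" where
  "Ck_carrier X Y = {f. f \<in> extensional (topspace X) \<and> continuous_map X Y f}"

text \<open>The choice \<open>K = {}\<close> yields the whole carrier, so the subbase does cover it.\<close>

definition Ck :: "'a topology \<Rightarrow> 'b topology \<Rightarrow> ('a \<Rightarrow> 'b) topology" where
  "Ck X Y = topology_generated_by
     {{f \<in> Ck_carrier X Y. f ` K \<subseteq> U} | K U. compactin X K \<and> openin Y U}"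

lemma topspace_Ck [simp]: "topspace (Ck X Y) = Ck_carrier X Y"
proof -
  have "\<exists>S. (\<exists>K U. S = {f \<in> Ck_carrier X Y. f ` K \<subseteq> U} \<and> compactin X K \<and> openin Y U) \<and> f \<in> S"
    if "f \<in> Ck_carrier X Y" for f
    using that by (intro exI[of _ "{f \<in> Ck_carrier X Y. f ` {} \<subseteq> {}}"] conjI exI[of _ "{}"]) auto
  then show ?thesis
    unfolding Ck_def topology_generated_by_topspace by blast
qed

lemma openin_Ck_subbasic:
  "compactin X K \<Longrightarrow> openin Y U \<Longrightarrow> openin (Ck X Y) {f \<in> Ck_carrier X Y. f ` K \<subseteq> U}"
  unfolding Ck_def by (rule topology_generated_by_Basis) blast

lemma closedin_Ck_subbasic:
  assumes K: "compactin X K" and C: "closedin Y C"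
  shows "closedin (Ck X Y) {f \<in> Ck_carrier X Y. f ` K \<subseteq> C}"
proof -
  have KX: "K \<subseteq> topspace X"
    using K by (rule compactin_subset_topspace)
  have "Ck_carrier X Y - {f \<in> Ck_carrier X Y. f ` K \<subseteq> C}
      = (\<Union>x\<in>K. {f \<in> Ck_carrier X Y. f ` {x} \<subseteq> topspace Y - C})"
    using KX by (auto simp: Ck_carrier_def continuous_map_def Pi_iff)
  moreover have "openin (Ck X Y) {f \<in> Ck_carrier X Y. f ` {x} \<subseteq> topspace Y - C}"
    if "x \<in> K" for x
    using that KX C by (intro openin_Ck_subbasic) (auto simp: closedin_def)
  ultimately show ?thesis
    unfolding closedin_def by auto
qed

lemma regular_T1_space_Ck:
  assumes Y: "regular_T1_space Y"
  shows "regular_T1_space (Ck X Y)"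
proof -
  have reg: "regular_space Y" and t1: "t1_space Y"
    using Y by (auto simp: regular_T1_space_def)
  let ?P = "\<lambda>W. \<forall>f\<in>W. \<exists>V C. openin (Ck X Y) V \<and> closedin (Ck X Y) C \<and> f \<in> V \<and> V \<subseteq> C \<and> C \<subseteq> W"
  let ?S = "{{f \<in> Ck_carrier X Y. f ` K \<subseteq> U} | K U. compactin X K \<and> openin Y U}"
  have P: "?P W" if "openin (Ck X Y) W" for W
  proof -
    have "generate_topology_on ?S W"
      using that unfolding Ck_def by (rule openin_topology_generated_by)
    then show ?thesis
    proof induction
      case Empty
      show ?case by simp
    next
      case (Int A B)
      show ?case
      proof
        fix f assume "f \<in> A \<inter> B"
        then obtain V C V' C' where "openin (Ck X Y) V" "closedin (Ck X Y) C" "f \<in> V" "V \<subseteq> C" "C \<subseteq> A"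
          "openin (Ck X Y) V'" "closedin (Ck X Y) C'" "f \<in> V'" "V' \<subseteq> C'" "C' \<subseteq> B"
          using Int.IH by (metis IntE)
        then show "\<exists>V C. openin (Ck X Y) V \<and> closedin (Ck X Y) C \<and> f \<in> V \<and> V \<subseteq> C \<and> C \<subseteq> A \<inter> B"
          by (intro exI[of _ "V \<inter> V'"] exI[of _ "C \<inter> C'"]) auto
      qed
    next
      case (UN \<K>)
      then show ?case by (meson Sup_upper UnionE order_trans)
    next
      case (Basis W)
      then obtain K U where W: "W = {f \<in> Ck_carrier X Y. f ` K \<subseteq> U}"
        and K: "compactin X K" and U: "openin Y U"
        by blast
      show ?case
      proof
        fix f assume f: "f \<in> W"
        have cK: "compactin Y (f ` K)"
          using f K W by (auto simp: Ck_carrier_def intro: image_compactin)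
        moreover have "closedin Y (topspace Y - U)" "disjnt (f ` K) (topspace Y - U)"
          using U f W by (auto simp: disjnt_def)
        ultimately obtain V V' where V: "openin Y V" "openin Y V'" "f ` K \<subseteq> V"
          "topspace Y - U \<subseteq> V'" "disjnt V V'"
          by (metis reg regular_space_compact_closed_separation)
        let ?C = "topspace Y - V'"
        have "V \<subseteq> ?C" "?C \<subseteq> U" "closedin Y ?C"
          using V openin_subset[OF V(1)] by (auto simp: disjnt_def)
        then show "\<exists>V C. openin (Ck X Y) V \<and> closedin (Ck X Y) C \<and> f \<in> V \<and> V \<subseteq> C \<and> C \<subseteq> W"
          using V f K W openin_Ck_subbasic[OF K V(1)] closedin_Ck_subbasic[OF K, of Y ?C]
          by (intro exI[of _ "{f \<in> Ck_carrier X Y. f ` K \<subseteq> V}"]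
                exI[of _ "{f \<in> Ck_carrier X Y. f ` K \<subseteq> ?C}"]) auto
      qed
    qed
  qed
  have "neighbourhood_base_of (closedin (Ck X Y)) (Ck X Y)"
    unfolding neighbourhood_base_of using P by meson
  then have "regular_space (Ck X Y)"
    by (simp add: neighbourhood_base_of_closedin)
  moreover have "t1_space (Ck X Y)"
    unfolding t1_space_def
  proof (intro ballI impI)
    fix f g assume fg: "f \<in> topspace (Ck X Y)" "g \<in> topspace (Ck X Y)" "f \<noteq> g"
    then obtain x where x: "x \<in> topspace X" "f x \<noteq> g x"
      by (auto simp: Ck_carrier_def intro: extensionalityI)
    have fx: "f x \<in> topspace Y" "g x \<in> topspace Y"
      using fg x by (auto simp: Ck_carrier_def continuous_map_def)
    have "openin Y (topspace Y - {g x})"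
      using t1 fx by (simp add: openin_diff t1_space_closedin_singleton)
    then show "\<exists>U. openin (Ck X Y) U \<and> f \<in> U \<and> g \<notin> U"
      using fg x fx openin_Ck_subbasic[of X "{x}" Y "topspace Y - {g x}"]
      by (intro exI[of _ "{f \<in> Ck_carrier X Y. f ` {x} \<subseteq> topspace Y - {g x}}"]) auto
  qed
  ultimately show ?thesis
    by (simp add: regular_T1_space_def)
qed

definition evenly_continuous :: "'a topology \<Rightarrow> 'b topology \<Rightarrow> ('a \<Rightarrow> 'b) set \<Rightarrow> bool" where
  "evenly_continuous X Y \<K> \<longleftrightarrow> \<K> \<subseteq> Ck_carrier X Y \<and>
     continuous_map (prod_topology (subtopology (Ck X Y) \<K>) X) Y (\<lambda>(f, x). f x)"

definition Ascoli_space :: "'a topology \<Rightarrow> bool" where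
  "Ascoli_space X \<longleftrightarrow> regular_T1_space X \<and>
     (\<forall>\<K>. compactin (Ck X euclideanreal) \<K> \<longrightarrow> evenly_continuous X euclideanreal \<K>)"

definition k_network :: "'a topology \<Rightarrow> 'a set set \<Rightarrow> bool" where
  "k_network X \<N> \<longleftrightarrow> \<N> \<subseteq> Pow (topspace X) \<and>
     (\<forall>U K. openin X U \<and> compactin X K \<and> K \<subseteq> U \<longrightarrow>
        (\<exists>\<F>. finite \<F> \<and> \<F> \<subseteq> \<N> \<and> K \<subseteq> \<Union>\<F> \<and> \<Union>\<F> \<subseteq> U))"

definition aleph0_space :: "'a topology \<Rightarrow> bool" where
  "aleph0_space X \<longleftrightarrow> regular_T1_space X \<and> (\<exists>\<N>. countable \<N> \<and> k_network X \<N>)"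

text \<open>A class of spaces is a set of topologies over one universe type \<open>'u\<close>. Sums, products and
  function spaces live over other types; they count as members of a class through their
  homeomorphic copies over \<open>'u\<close>, so each closure condition ranges over all such copies. If \<open>'u\<close> has
  at least the cardinality of the continuum, this loses nothing for the class generated by the
  separable metrizable spaces: every space obtained from them by the operations below is an
  \<open>\<aleph>\<^sub>0\<close>-space, hence has at most continuum many points and so has a copy over \<open>'u\<close>.

  Countable families are indexed by arbitrary subsets of \<open>nat\<close>.\<close>

definition stable_class :: "'u topology set \<Rightarrow> bool" where
  "stable_class \<X> \<longleftrightarrow>
     (\<forall>X\<in>\<X>. regular_T1_space X) \<and>
     (\<forall>X\<in>\<X>. \<forall>S. S \<subseteq> topspace X \<longrightarrow> subtopology X S \<in> \<X>) \<and>
     (\<forall>X\<in>\<X>. \<forall>Z. X homeomorphic_space Z \<longrightarrow> Z \<in> \<X>) \<and>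
     (\<forall>(I :: nat set) X Z. (\<forall>i\<in>I. X i \<in> \<X>) \<and> sum_topology X I homeomorphic_space Z \<longrightarrow> Z \<in> \<X>) \<and>
     (\<forall>(I :: nat set) X Z. (\<forall>i\<in>I. X i \<in> \<X>) \<and> product_topology X I homeomorphic_space Z \<longrightarrow> Z \<in> \<X>)"

definition Ck_stable_class :: "'u topology set \<Rightarrow> bool" where
  "Ck_stable_class \<X> \<longleftrightarrow> stable_class \<X> \<and>
     (\<forall>X\<in>\<X>. \<forall>Y\<in>\<X>. \<forall>Z. Lindelof_space X \<and> Ck X Y homeomorphic_space Z \<longrightarrow> Z \<in> \<X>)"

definition Ck_closure :: "'u topology set \<Rightarrow> 'u topology set" where
  "Ck_closure \<X> = \<Inter>{\<Y>. Ck_stable_class \<Y> \<and> \<X> \<subseteq> \<Y>}"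

definition separable_metrizable_class :: "'u topology set" where
  "separable_metrizable_class = {X. separable_space X \<and> metrizable_space X}"

text \<open>The class of all regular \<open>T\<^sub>1\<close>-spaces is \<open>C\<^sub>k\<close>-stable; hence the intersection above is over a
  nonempty family and \<^const>\<open>Ck_closure\<close> really yields the smallest \<open>C\<^sub>k\<close>-stable class.\<close>

lemma Ck_stable_classI:
  fixes \<X> :: "'u topology set"
  assumes "\<And>X. X \<in> \<X> \<Longrightarrow> regular_T1_space X"
    and "\<And>X S. X \<in> \<X> \<Longrightarrow> S \<subseteq> topspace X \<Longrightarrow> subtopology X S \<in> \<X>"
    and "\<And>X Z. X \<in> \<X> \<Longrightarrow> X homeomorphic_space Z \<Longrightarrow> Z \<in> \<X>"
    and "\<And>(I :: nat set) X Z. \<forall>i\<in>I. X i \<in> \<X> \<Longrightarrow> sum_topology X I homeomorphic_space Z \<Longrightarrow> Z \<in> \<X>"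
    and "\<And>(I :: nat set) X Z. \<forall>i\<in>I. X i \<in> \<X> \<Longrightarrow> product_topology X I homeomorphic_space Z \<Longrightarrow> Z \<in> \<X>"
    and "\<And>X Y Z. X \<in> \<X> \<Longrightarrow> Y \<in> \<X> \<Longrightarrow> Lindelof_space X \<Longrightarrow> Ck X Y homeomorphic_space Z \<Longrightarrow> Z \<in> \<X>"
  shows "Ck_stable_class \<X>"
  unfolding Ck_stable_class_def stable_class_def
  by (intro conjI allI ballI impI; (elim conjE)?) (fact assms | erule (3) assms | erule (1) assms | erule assms)+

lemma homeomorphic_regular_T1_space:
  "X homeomorphic_space Y \<Longrightarrow> regular_T1_space X \<longleftrightarrow> regular_T1_space Y"
  by (simp add: regular_T1_space_def homeomorphic_regular_space homeomorphic_t1_space)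

lemma regular_T1_space_sum_topology:
  assumes "\<And>i. i \<in> I \<Longrightarrow> regular_T1_space (X i)"
  shows "regular_T1_space (sum_topology X I)"
proof -
  have "\<exists>V C. openin (sum_topology X I) V \<and> closedin (sum_topology X I) C \<and> p \<in> V \<and> V \<subseteq> C \<and> C \<subseteq> W"
    if W: "openin (sum_topology X I) W" and p: "p \<in> W" for W p
  proof -
    obtain i x where ix: "p = (i, x)" by force
    have i: "i \<in> I"
      using openin_subset[OF W] p ix by auto
    define W' where "W' = {x. (i, x) \<in> W}"
    have "openin (X i) W'"
      using W i by (auto simp: openin_sum_topology W'_def)
    moreover have "x \<in> W'"
      using p ix by (simp add: W'_def)
    moreover have "neighbourhood_base_of (closedin (X i)) (X i)"
      using assms i by (simp add: neighbourhood_base_of_closedin regular_T1_space_def)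
    ultimately have "\<exists>V C. openin (X i) V \<and> closedin (X i) C \<and> x \<in> V \<and> V \<subseteq> C \<and> C \<subseteq> W'"
      by (simp only: neighbourhood_base_of)
    then obtain V C where VC: "openin (X i) V" "closedin (X i) C" "x \<in> V" "V \<subseteq> C" "C \<subseteq> W'"
      by (elim exE conjE)
    have "openin (sum_topology X I) (Pair i ` V)"
      using VC(1) open_map_component_injection[OF i] unfolding open_map_def by blast
    moreover have "closedin (sum_topology X I) (Pair i ` C)"
      using VC(2) closed_map_component_injection[OF i] unfolding closed_map_def by blast
    moreover have "Pair i ` C \<subseteq> W"
      using VC(5) by (auto simp: W'_def)
    ultimately show ?thesis
      using VC(3,4) ix by (intro exI[of _ "Pair i ` V"] exI[of _ "Pair i ` C"]) auto
  qed
  then have "neighbourhood_base_of (closedin (sum_topology X I)) (sum_topology X I)"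
    unfolding neighbourhood_base_of by meson
  then have "regular_space (sum_topology X I)"
    by (simp add: neighbourhood_base_of_closedin)
  moreover have "closedin (sum_topology X I) {p}" if p: "p \<in> topspace (sum_topology X I)" for p
  proof -
    obtain i x where ix: "p = (i, x)" "i \<in> I" "x \<in> topspace (X i)" using p by auto
    then have "closedin (X i) {x}"
      using assms by (simp add: regular_T1_space_def t1_space_closedin_singleton)
    then have "closedin (sum_topology X I) (Pair i ` {x})"
      using closed_map_component_injection[of i I X] ix by (simp only: closed_map_def)
    then show ?thesis using ix by simp
  qed
  ultimately show ?thesis
    by (simp add: regular_T1_space_def t1_space_closedin_singleton)
qed

lemma Ck_stable_class_regular_T1: "Ck_stable_class {X :: 'u topology. regular_T1_space X}"
proof (rule Ck_stable_classI, unfold mem_Collect_eq)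
  show "regular_T1_space (subtopology X S)" if "regular_T1_space X" for X :: "'u topology" and S
    using that by (simp add: regular_T1_space_def regular_space_subtopology t1_space_subtopology)
  show "regular_T1_space Z" if "regular_T1_space X" "X homeomorphic_space Z"
    for X Z :: "'u topology"
    using that by (simp add: homeomorphic_regular_T1_space)
  show "regular_T1_space Z"
    if "\<forall>i\<in>I. regular_T1_space (X i)" "sum_topology X I homeomorphic_space Z"
    for X :: "nat \<Rightarrow> 'u topology" and I and Z :: "'u topology"
    using regular_T1_space_sum_topology[of I X] that(1)
    by (simp add: homeomorphic_regular_T1_space[OF that(2), symmetric])
  show "regular_T1_space Z"
    if "\<forall>i\<in>I. regular_T1_space (X i)" "product_topology X I homeomorphic_space Z"
    for X :: "nat \<Rightarrow> 'u topology" and I and Z :: "'u topology"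
  proof -
    have "regular_T1_space (product_topology X I)"
      using that(1)
      by (auto simp: regular_T1_space_def regular_space_product_topology t1_space_product_topology)
    then show ?thesis
      by (simp add: homeomorphic_regular_T1_space[OF that(2)])
  qed
  show "regular_T1_space Z" if "regular_T1_space Y" "Ck X Y homeomorphic_space Z"
    for X Y Z :: "'u topology"
    using regular_T1_space_Ck[OF that(1), of X]
    by (simp add: homeomorphic_regular_T1_space[OF that(2)])
qed

lemma separable_metrizable_regular_T1:
  "separable_metrizable_class \<subseteq> {X. regular_T1_space X}"
  by (auto simp: separable_metrizable_class_def regular_T1_space_def
      metrizable_imp_regular_space metrizable_imp_t1_space)

lemma Ck_stable_classD:
  fixes \<X> :: "'u topology set"
  assumes "Ck_stable_class \<X>"
  shows "X \<in> \<X> \<Longrightarrow> regular_T1_space X"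
    and "X \<in> \<X> \<Longrightarrow> S \<subseteq> topspace X \<Longrightarrow> subtopology X S \<in> \<X>"
    and "X \<in> \<X> \<Longrightarrow> X homeomorphic_space Z \<Longrightarrow> Z \<in> \<X>"
    and "\<forall>i\<in>I. F i \<in> \<X> \<Longrightarrow> sum_topology F (I :: nat set) homeomorphic_space Z \<Longrightarrow> Z \<in> \<X>"
    and "\<forall>i\<in>I. F i \<in> \<X> \<Longrightarrow> product_topology F (I :: nat set) homeomorphic_space Z \<Longrightarrow> Z \<in> \<X>"
    and "X \<in> \<X> \<Longrightarrow> Y \<in> \<X> \<Longrightarrow> Lindelof_space X \<Longrightarrow> Ck X Y homeomorphic_space Z \<Longrightarrow> Z \<in> \<X>"
proof -
  note c = assms[unfolded Ck_stable_class_def stable_class_def]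
  note s = c[THEN conjunct1]
  show "X \<in> \<X> \<Longrightarrow> regular_T1_space X"
    by (rule s[THEN conjunct1, THEN bspec])
  show "X \<in> \<X> \<Longrightarrow> S \<subseteq> topspace X \<Longrightarrow> subtopology X S \<in> \<X>"
    by (rule s[THEN conjunct2, THEN conjunct1, THEN bspec, THEN spec, THEN mp])
  show "X \<in> \<X> \<Longrightarrow> X homeomorphic_space Z \<Longrightarrow> Z \<in> \<X>"
    by (rule s[THEN conjunct2, THEN conjunct2, THEN conjunct1, THEN bspec, THEN spec, THEN mp])
  show "\<forall>i\<in>I. F i \<in> \<X> \<Longrightarrow> sum_topology F I homeomorphic_space Z \<Longrightarrow> Z \<in> \<X>"
    by (rule s[THEN conjunct2, THEN conjunct2, THEN conjunct2, THEN conjunct1,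
          THEN spec, THEN spec, THEN spec, THEN mp, OF conjI])
  show "\<forall>i\<in>I. F i \<in> \<X> \<Longrightarrow> product_topology F I homeomorphic_space Z \<Longrightarrow> Z \<in> \<X>"
    by (rule s[THEN conjunct2, THEN conjunct2, THEN conjunct2, THEN conjunct2,
          THEN spec, THEN spec, THEN spec, THEN mp, OF conjI])
  show "X \<in> \<X> \<Longrightarrow> Y \<in> \<X> \<Longrightarrow> Lindelof_space X \<Longrightarrow> Ck X Y homeomorphic_space Z \<Longrightarrow> Z \<in> \<X>"
    by (rule c[THEN conjunct2, THEN bspec, THEN bspec, THEN spec, THEN mp, OF _ _ conjI])
qed

lemma Ck_stable_class_Inter:
  fixes \<A> :: "'u topology set set"
  assumes st: "\<And>\<Y>. \<Y> \<in> \<A> \<Longrightarrow> Ck_stable_class \<Y>" and ne: "\<A> \<noteq> {}"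
  shows "Ck_stable_class (\<Inter>\<A>)"
proof (rule Ck_stable_classI)
  show "regular_T1_space X" if "X \<in> \<Inter>\<A>" for X
  proof -
    obtain \<Y> where "\<Y> \<in> \<A>"
      using ne by auto
    then show ?thesis
      using that Ck_stable_classD(1)[OF st] by auto
  qed
  show "subtopology X S \<in> \<Inter>\<A>" if "X \<in> \<Inter>\<A>" "S \<subseteq> topspace X" for X S
    by (rule InterI, rule Ck_stable_classD(2)[OF st]) (use that in auto)
  show "Z \<in> \<Inter>\<A>" if "X \<in> \<Inter>\<A>" "X homeomorphic_space Z" for X Z
    by (rule InterI, rule Ck_stable_classD(3)[OF st _ that(2)]) (use that(1) in auto)
  show "Z \<in> \<Inter>\<A>" if "\<forall>i\<in>I. X i \<in> \<Inter>\<A>" "sum_topology X I homeomorphic_space Z"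
    for I :: "nat set" and X Z
    by (rule InterI, rule Ck_stable_classD(4)[OF st _ that(2)]) (use that(1) in auto)
  show "Z \<in> \<Inter>\<A>" if "\<forall>i\<in>I. X i \<in> \<Inter>\<A>" "product_topology X I homeomorphic_space Z"
    for I :: "nat set" and X Z
    by (rule InterI, rule Ck_stable_classD(5)[OF st _ that(2)]) (use that(1) in auto)
  show "Z \<in> \<Inter>\<A>"
    if "X \<in> \<Inter>\<A>" "Y \<in> \<Inter>\<A>" "Lindelof_space X" "Ck X Y homeomorphic_space Z" for X Y Z
    by (rule InterI, rule Ck_stable_classD(6)[OF st _ _ that(3,4)]) (use that(1,2) in auto)
qed

lemma Ck_closure_smallest:
  assumes "\<X> \<subseteq> {X. regular_T1_space X}"
  shows "Ck_stable_class (Ck_closure \<X>)" "\<X> \<subseteq> Ck_closure \<X>"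
    "\<And>\<Y>. Ck_stable_class \<Y> \<Longrightarrow> \<X> \<subseteq> \<Y> \<Longrightarrow> Ck_closure \<X> \<subseteq> \<Y>"
proof -
  show "Ck_stable_class (Ck_closure \<X>)"
    unfolding Ck_closure_def using assms Ck_stable_class_regular_T1
    by (intro Ck_stable_class_Inter) auto
qed (auto simp: Ck_closure_def)

end

(* An aleph_0-space X is a compact-covering image of a separable metrizable space M of sequences of
   naturals (Michael), so C_k(X) embeds into C_k(M) and lies in the class. A countable k-network
   of X yields a countable network of C_k(X), which is therefore Lindelof, so C_k(C_k(X)) lies in the
   class as well. For Ascoli X the evaluation map embeds X into C_k(C_k(X)). *)

theory Submission
  imports Defs
begin

section \<open>Function spaces\<close>

text \<open>The closure clause for C_k(Y,Z) asks for a Lindelof Y that is already a member, and X is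
  not known to be one until the very end. Hence C_k(X) is reached only as a subspace of C_k(M). For
  this, p must lift compact sets and not merely points: injectivity of composition with p needs only
  points, but continuity of its inverse is tested on compact sets of X. The clause then applies a
  second time because C_k(X) has itself become a Lindelof member. Even continuity makes the
  evaluation map continuous; that it is open onto its image comes from complete regularity, which
  regular Lindelof spaces have. A second obstacle is the typing of classes: members are topologies
  over \<open>'u\<close>, whereas M and the function spaces live over other types. They are handled
  through copies over \<open>'u\<close>, which exist since each of these spaces has at most
  continuum many points; for the function spaces this follows from separability of the
  domain.\<close>

lemma continuous_map_into_Ck:
  assumes "\<And>t. t \<in> topspace T \<Longrightarrow> \<phi> t \<in> Ck_carrier X Y"
    and "\<And>K U. compactin X K \<Longrightarrow> openin Y U \<Longrightarrow> openin T {t \<in> topspace T. \<phi> t ` K \<subseteq> U}"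
  shows "continuous_map T (Ck X Y) \<phi>"
  unfolding Ck_def
proof (rule continuous_on_generated_topo)
  fix W assume "W \<in> {{f \<in> Ck_carrier X Y. f ` K \<subseteq> U} |K U. compactin X K \<and> openin Y U}"
  then obtain K U where KU: "compactin X K" "openin Y U" "W = {f \<in> Ck_carrier X Y. f ` K \<subseteq> U}"
    by blast
  then have "\<phi> -` W \<inter> topspace T = {t \<in> topspace T. \<phi> t ` K \<subseteq> U}"
    using assms(1) by auto
  then show "openin T (\<phi> -` W \<inter> topspace T)"
    using assms(2) KU by simp
next
  have "openin (Ck X Y) (Ck_carrier X Y)"
    using openin_topspace[of "Ck X Y"] by simp
  then have "\<Union> {{f \<in> Ck_carrier X Y. f ` K \<subseteq> U} |K U. compactin X K \<and> openin Y U} = Ck_carrier X Y"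
    using topspace_Ck[of X Y] unfolding Ck_def topology_generated_by_topspace by simp
  then show "\<phi> ` topspace T \<subseteq> \<Union> {{f \<in> Ck_carrier X Y. f ` K \<subseteq> U} |K U. compactin X K \<and> openin Y U}"
    using assms(1) by auto
qed

lemma continuous_map_Ck_compose:
  assumes p: "continuous_map X' X p" and h: "continuous_map Y Y' h"
  shows "continuous_map (Ck X Y) (Ck X' Y') (\<lambda>f. restrict (h \<circ> f \<circ> p) (topspace X'))"
proof (rule continuous_map_into_Ck)
  fix f assume "f \<in> topspace (Ck X Y)"
  then have "continuous_map X' Y' (h \<circ> f \<circ> p)"
    using p h by (auto simp: Ck_carrier_def intro!: continuous_map_compose)
  then show "restrict (h \<circ> f \<circ> p) (topspace X') \<in> Ck_carrier X' Y'"
    by (simp add: Ck_carrier_def continuous_map_eq[of X' Y' "h \<circ> f \<circ> p"])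
next
  fix K U assume K: "compactin X' K" and U: "openin Y' U"
  let ?V = "{y \<in> topspace Y. h y \<in> U}"
  have KX: "K \<subseteq> topspace X'" using K by (rule compactin_subset_topspace)
  have pK: "compactin X (p ` K)" using K p by (rule image_compactin)
  have V: "openin Y ?V" using h U by (rule openin_continuous_map_preimage)
  have "{f \<in> topspace (Ck X Y). restrict (h \<circ> f \<circ> p) (topspace X') ` K \<subseteq> U}
      = {f \<in> Ck_carrier X Y. f ` p ` K \<subseteq> ?V}"
    using KX compactin_subset_topspace[OF pK]
    by (fastforce simp: Ck_carrier_def continuous_map_def Pi_iff image_subset_iff subset_iff)
  then show "openin (Ck X Y) {f \<in> topspace (Ck X Y). restrict (h \<circ> f \<circ> p) (topspace X') ` K \<subseteq> U}"
    using openin_Ck_subbasic[OF pK V] by simp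
qed

lemma homeomorphic_space_Ck:
  assumes "X homeomorphic_space X'" and "Y homeomorphic_space Y'"
  shows "Ck X Y homeomorphic_space Ck X' Y'"
proof -
  obtain p q where pq: "continuous_map X X' p" "continuous_map X' X q"
    "\<And>x. x \<in> topspace X \<Longrightarrow> q (p x) = x" "\<And>x. x \<in> topspace X' \<Longrightarrow> p (q x) = x"
    using assms(1) by (auto simp: homeomorphic_space_def homeomorphic_maps_def)
  obtain h k where hk: "continuous_map Y Y' h" "continuous_map Y' Y k"
    "\<And>x. x \<in> topspace Y \<Longrightarrow> k (h x) = x" "\<And>x. x \<in> topspace Y' \<Longrightarrow> h (k x) = x"
    using assms(2) by (auto simp: homeomorphic_space_def homeomorphic_maps_def)
  have sub: "p x \<in> topspace X'" if "x \<in> topspace X" for x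
    using pq(1) that by (auto simp: continuous_map_def)
  have sub': "q x \<in> topspace X" if "x \<in> topspace X'" for x
    using pq(2) that by (auto simp: continuous_map_def)
  have "homeomorphic_maps (Ck X Y) (Ck X' Y')
      (\<lambda>f. restrict (h \<circ> f \<circ> q) (topspace X')) (\<lambda>g. restrict (k \<circ> g \<circ> p) (topspace X))"
    unfolding homeomorphic_maps_def
  proof (intro conjI ballI continuous_map_Ck_compose pq hk)
    fix f assume f: "f \<in> topspace (Ck X Y)"
    show "restrict (k \<circ> restrict (h \<circ> f \<circ> q) (topspace X') \<circ> p) (topspace X) = f"
    proof (rule extensionalityI[of _ "topspace X"])
      fix x assume "x \<in> topspace X"
      moreover from this f have "f x \<in> topspace Y"
        by (auto simp: Ck_carrier_def continuous_map_def)
      ultimately show "restrict (k \<circ> restrict (h \<circ> f \<circ> q) (topspace X') \<circ> p) (topspace X) x = f x"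
        by (simp add: sub pq hk)
    qed (use f in \<open>auto simp: Ck_carrier_def\<close>)
  next
    fix f assume f: "f \<in> topspace (Ck X' Y')"
    show "restrict (h \<circ> restrict (k \<circ> f \<circ> p) (topspace X) \<circ> q) (topspace X') = f"
    proof (rule extensionalityI[of _ "topspace X'"])
      fix x assume "x \<in> topspace X'"
      moreover from this f have "f x \<in> topspace Y'"
        by (auto simp: Ck_carrier_def continuous_map_def)
      ultimately show "restrict (h \<circ> restrict (k \<circ> f \<circ> p) (topspace X) \<circ> q) (topspace X') x = f x"
        by (simp add: sub' pq hk)
    qed (use f in \<open>auto simp: Ck_carrier_def\<close>)
  qed
  then show ?thesis
    by (rule homeomorphic_maps_imp_homeomorphic_space)
qed

text \<open>Composition with \<open>p\<close> is continuous for any continuous \<open>p\<close>. Its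
  inverse on the image is continuous because \<open>f\<close> maps \<open>K\<close> into
  \<open>U\<close> exactly when \<open>f \<circ> p\<close> maps a compact lift \<open>L\<close> of
  \<open>K\<close> into \<open>U\<close>.\<close>

lemma compact_covering_imp_Ck_embeds:
  assumes p: "continuous_map M X p"
    and cover: "\<And>K. compactin X K \<Longrightarrow> \<exists>L. compactin M L \<and> p ` L = K"
  obtains S where "S \<subseteq> topspace (Ck M Y)" "Ck X Y homeomorphic_space subtopology (Ck M Y) S"
proof -
  define \<phi> where "\<phi> = (\<lambda>f::'b \<Rightarrow> 'c. restrict (f \<circ> p) (topspace M))"
  define S where "S = \<phi> ` Ck_carrier X Y"
  have cont: "continuous_map (Ck X Y) (Ck M Y) \<phi>"
    using continuous_map_Ck_compose[OF p, of Y Y id] by (simp add: \<phi>_def)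
  then have S: "S \<subseteq> topspace (Ck M Y)"
    unfolding S_def by (metis continuous_map_image_subset_topspace topspace_Ck)
  have inj: "inj_on \<phi> (Ck_carrier X Y)"
  proof (rule inj_onI)
    fix f g assume fg: "f \<in> Ck_carrier X Y" "g \<in> Ck_carrier X Y" "\<phi> f = \<phi> g"
    show "f = g"
    proof (rule extensionalityI[of _ "topspace X"])
      fix x assume "x \<in> topspace X"
      \<comment> \<open>Lifting singletons shows that \<open>p\<close> is onto.\<close>
      then obtain L where L: "compactin M L" "p ` L = {x}"
        using cover[of "{x}"] by auto
      then obtain t where "t \<in> topspace M" "p t = x"
        using compactin_subset_topspace[OF L(1)] by (metis imageE insertI1 subsetD)
      then show "f x = g x"
        using fun_cong[OF fg(3), of t] by (simp add: \<phi>_def)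
    qed (use fg in \<open>auto simp: Ck_carrier_def\<close>)
  qed
  define \<psi> where "\<psi> = inv_into (Ck_carrier X Y) \<phi>"
  have \<psi>: "\<psi> (\<phi> f) = f" if "f \<in> Ck_carrier X Y" for f
    using inj that by (simp add: \<psi>_def)
  have "continuous_map (subtopology (Ck M Y) S) (Ck X Y) \<psi>"
  proof (rule continuous_map_into_Ck)
    show "\<psi> t \<in> Ck_carrier X Y" if "t \<in> topspace (subtopology (Ck M Y) S)" for t
      using that \<psi> by (auto simp: S_def)
  next
    fix K U assume K: "compactin X K" and U: "openin Y U"
    obtain L where L: "compactin M L" "p ` L = K"
      using cover[OF K] by blast
    have LM: "L \<subseteq> topspace M" using L(1) by (rule compactin_subset_topspace)
    have "\<phi> f ` L = f ` K" for f
      using LM L(2) by (force simp: \<phi>_def)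
    then have "\<psi> t ` K \<subseteq> U \<longleftrightarrow> t ` L \<subseteq> U" if "t \<in> S" for t
      using that \<psi> unfolding S_def by (metis imageE)
    then have "{t \<in> topspace (subtopology (Ck M Y) S). \<psi> t ` K \<subseteq> U}
        = {g \<in> Ck_carrier M Y. g ` L \<subseteq> U} \<inter> S"
      using S by (simp only: topspace_Ck topspace_subtopology) blast
    then show "openin (subtopology (Ck M Y) S) {t \<in> topspace (subtopology (Ck M Y) S). \<psi> t ` K \<subseteq> U}"
      using openin_Ck_subbasic[OF L(1) U] by (simp add: openin_subtopology_Int)
  qed
  then have "homeomorphic_maps (Ck X Y) (subtopology (Ck M Y) S) \<phi> \<psi>"
    using cont \<psi> by (auto simp: homeomorphic_maps_def continuous_map_in_subtopology S_def)
  then show ?thesis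
    using that S homeomorphic_maps_imp_homeomorphic_space by blast
qed

text \<open>For a compact set of functions, even continuity makes evaluation jointly continuous, and
  the tube lemma turns this into continuity of \<open>\<delta>\<close> for the compact-open
  topology. Real functions separating points from closed sets give the rest.\<close>

lemma Ascoli_embeds_bidual:
  assumes X: "completely_regular_space X" and A: "Ascoli_space X"
  obtains S where "S \<subseteq> topspace (Ck (Ck X euclideanreal) euclideanreal)"
    "X homeomorphic_space subtopology (Ck (Ck X euclideanreal) euclideanreal) S"
proof -
  let ?F = "Ck X euclideanreal"
  define \<delta> where "\<delta> = (\<lambda>x. restrict (\<lambda>f::'a \<Rightarrow> real. f x) (Ck_carrier X euclideanreal))"
  have t1: "t1_space X" using A by (simp add: Ascoli_space_def regular_T1_space_def)
  have carrier: "\<delta> x \<in> Ck_carrier ?F euclideanreal" if "x \<in> topspace X" for x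
  proof -
    have "openin ?F {f \<in> topspace ?F. \<delta> x f \<in> U}" if "openin euclideanreal U" for U
    proof -
      have "{f \<in> topspace ?F. \<delta> x f \<in> U} = {f \<in> Ck_carrier X euclideanreal. f ` {x} \<subseteq> U}"
        by (auto simp: \<delta>_def)
      then show ?thesis
        using openin_Ck_subbasic[of X "{x}" euclideanreal U] that \<open>x \<in> topspace X\<close> by simp
    qed
    then show ?thesis
      by (auto simp: Ck_carrier_def \<delta>_def continuous_map_def)
  qed
  have cont: "continuous_map X (Ck ?F euclideanreal) \<delta>"
  proof (rule continuous_map_into_Ck[OF carrier])
    fix \<K> U assume K: "compactin ?F \<K>" and U: "openin euclideanreal U"
    have KC: "\<K> \<subseteq> Ck_carrier X euclideanreal"
      using compactin_subset_topspace[OF K] by simp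
    let ?P = "prod_topology (subtopology ?F \<K>) X"
    let ?W = "{z \<in> topspace ?P. (\<lambda>(f, x). f x) z \<in> U}"
    have "evenly_continuous X euclideanreal \<K>"
      using A K by (auto simp: Ascoli_space_def)
    then have W: "openin ?P ?W"
      unfolding evenly_continuous_def using U openin_continuous_map_preimage by blast
    have K': "compactin (subtopology ?F \<K>) \<K>"
      using K by (simp add: compactin_subtopology)
    \<comment> \<open>The condition now says that the compact slice over \<open>x\<close> lies in
      the open set \<open>?W\<close>, which is the form the tube lemma needs.\<close>
    have eq: "{x \<in> topspace X. \<delta> x ` \<K> \<subseteq> U} = {x \<in> topspace X. \<K> \<times> {x} \<subseteq> ?W}"
      using KC by (auto simp: \<delta>_def image_subset_iff subset_iff)
    show "openin X {x \<in> topspace X. \<delta> x ` \<K> \<subseteq> U}"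
      unfolding eq
    proof (subst openin_subopen, intro ballI)
      fix x assume x: "x \<in> {x \<in> topspace X. \<K> \<times> {x} \<subseteq> ?W}"
      then obtain V V' where V: "openin X V'" "\<K> \<subseteq> V" "x \<in> V'" "V \<times> V' \<subseteq> ?W"
        using tube_lemma_left[OF W K', of x] by blast
      then show "\<exists>T. openin X T \<and> x \<in> T \<and> T \<subseteq> {x \<in> topspace X. \<K> \<times> {x} \<subseteq> ?W}"
        using openin_subset[OF V(1)] by (intro exI[of _ V']) blast
    qed
  qed
  \<comment> \<open>This serves twice: with \<open>W\<close> the complement of a point it gives
    injectivity, and for general \<open>W\<close> it gives openness onto the image.\<close>
  have sep: "\<exists>V. openin (Ck ?F euclideanreal) V \<and> \<delta> x \<in> V \<and>
      (\<forall>z\<in>topspace X. \<delta> z \<in> V \<longrightarrow> z \<in> W)" if W: "openin X W" "x \<in> W" for W x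
  proof -
    obtain f where f: "continuous_map X euclideanreal f" "f x = 0" "f ` (topspace X - W) \<subseteq> {1}"
      using X W unfolding completely_regular_space_alt' by blast
    have x: "x \<in> topspace X" using W openin_subset by blast
    define g where "g = restrict f (topspace X)"
    have g: "g \<in> Ck_carrier X euclideanreal"
      using f(1) by (simp add: Ck_carrier_def g_def continuous_map_eq[of X euclideanreal f])
    \<comment> \<open>The function \<open>g\<close> is 0 at \<open>x\<close> and 1 off
      \<open>W\<close>, so the bound 1 on the value at \<open>g\<close> forces the evaluation point
      into \<open>W\<close>.\<close>
    let ?V = "{\<phi> \<in> Ck_carrier ?F euclideanreal. \<phi> ` {g} \<subseteq> {..<1}}"
    have "openin (Ck ?F euclideanreal) ?V"
      using g by (intro openin_Ck_subbasic) auto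
    moreover have "\<delta> x \<in> ?V"
      using carrier[OF x] g f(2) x by (simp add: \<delta>_def g_def)
    moreover have "\<forall>z\<in>topspace X. \<delta> z \<in> ?V \<longrightarrow> z \<in> W"
      using g f(3) by (auto simp: \<delta>_def g_def)
    ultimately show ?thesis by blast
  qed
  have inj: "inj_on \<delta> (topspace X)"
  proof (rule inj_onI, rule ccontr)
    fix x y assume xy: "x \<in> topspace X" "y \<in> topspace X" "\<delta> x = \<delta> y" "x \<noteq> y"
    then have "openin X (topspace X - {y})"
      using t1 by (simp add: openin_diff t1_space_closedin_singleton)
    then show False
      using sep[of "topspace X - {y}" x] xy by auto
  qed
  define S where "S = \<delta> ` topspace X"
  have S: "S \<subseteq> topspace (Ck ?F euclideanreal)"
    using carrier by (auto simp: S_def)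
  have "open_map X (subtopology (Ck ?F euclideanreal) S) \<delta>"
    unfolding open_map_def
  proof (intro allI impI)
    fix W assume W: "openin X W"
    show "openin (subtopology (Ck ?F euclideanreal) S) (\<delta> ` W)"
    proof (subst openin_subopen, intro ballI)
      fix y assume "y \<in> \<delta> ` W"
      then obtain x where x: "x \<in> W" "y = \<delta> x" by blast
      obtain V where V: "openin (Ck ?F euclideanreal) V" "\<delta> x \<in> V"
        "\<forall>z\<in>topspace X. \<delta> z \<in> V \<longrightarrow> z \<in> W"
        using sep[OF W x(1)] by blast
      have "openin (subtopology (Ck ?F euclideanreal) S) (V \<inter> S)"
        using V(1) by (rule openin_subtopology_Int)
      then show "\<exists>T. openin (subtopology (Ck ?F euclideanreal) S) T \<and> y \<in> T \<and> T \<subseteq> \<delta> ` W"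
        using V(2,3) x openin_subset[OF W] by (intro exI[of _ "V \<inter> S"]) (auto simp: S_def)
    qed
  qed
  moreover have "continuous_map X (subtopology (Ck ?F euclideanreal) S) \<delta>"
    using cont by (auto simp: continuous_map_in_subtopology S_def)
  moreover have "\<delta> ` topspace X = topspace (subtopology (Ck ?F euclideanreal) S)"
    using S by (auto simp: S_def)
  ultimately have "homeomorphic_map X (subtopology (Ck ?F euclideanreal) S) \<delta>"
    using inj by (intro bijective_open_imp_homeomorphic_map)
  then show ?thesis
    using that S homeomorphic_map_imp_homeomorphic_space by blast
qed

section \<open>Countable networks\<close>

text \<open>Members need be neither open nor contained in the space, so this is weaker than a
  countable base.\<close>

definition countable_network :: "'a topology \<Rightarrow> 'a set set \<Rightarrow> bool" where
  "countable_network X \<N> \<longleftrightarrow>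
     countable \<N> \<and> (\<forall>U x. openin X U \<and> x \<in> U \<longrightarrow> (\<exists>A\<in>\<N>. x \<in> A \<and> A \<subseteq> U))"

text \<open>The network members that fit inside some set of the cover already cover the space; it
  suffices to pick one set of the cover for each of them.\<close>

lemma countable_network_imp_Lindelof:
  assumes "countable_network X \<N>"
  shows "Lindelof_space X"
  unfolding Lindelof_space_alt
proof (intro allI impI)
  fix \<U> assume U: "(\<forall>U\<in>\<U>. openin X U) \<and> topspace X \<subseteq> \<Union>\<U>"
  define \<M> where "\<M> = {A\<in>\<N>. \<exists>U\<in>\<U>. A \<subseteq> U}"
  have "\<forall>A\<in>\<M>. \<exists>U. U \<in> \<U> \<and> A \<subseteq> U"
    by (auto simp: \<M>_def)
  from bchoice[OF this] obtain h where h: "\<And>A. A \<in> \<M> \<Longrightarrow> h A \<in> \<U> \<and> A \<subseteq> h A"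
    by auto
  have "countable (h ` \<M>)"
    unfolding \<M>_def using assms[unfolded countable_network_def, THEN conjunct1] by simp
  moreover have "h ` \<M> \<subseteq> \<U>" using h by blast
  moreover have "topspace X \<subseteq> \<Union>(h ` \<M>)"
  proof
    fix x assume "x \<in> topspace X"
    then obtain U where Ux: "U \<in> \<U>" "x \<in> U" using U by blast
    then obtain A where "A \<in> \<N>" "x \<in> A" "A \<subseteq> U"
      using assms U unfolding countable_network_def by meson
    moreover from this have "A \<in> \<M>" using Ux by (auto simp: \<M>_def)
    ultimately show "x \<in> \<Union>(h ` \<M>)" using h[of A] by (meson UN_I subsetD)
  qed
  ultimately show "\<exists>\<V>. countable \<V> \<and> \<V> \<subseteq> \<U> \<and> topspace X \<subseteq> \<Union>\<V>" by meson
qed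

text \<open>One point from each network member that meets the space gives a dense set.\<close>

lemma countable_network_imp_separable:
  assumes "countable_network X \<N>"
  shows "separable_space X"
proof -
  define h where "h = (\<lambda>A. SOME x. x \<in> A \<inter> topspace X)"
  define D where "D = h ` {A\<in>\<N>. A \<inter> topspace X \<noteq> {}}"
  have h: "h A \<in> A \<inter> topspace X" if "A \<inter> topspace X \<noteq> {}" for A
    unfolding h_def using that by (meson all_not_in_conv someI_ex)
  have "x \<in> X closure_of D" if x: "x \<in> topspace X" for x
    unfolding in_closure_of
  proof (intro conjI allI impI)
    fix T assume "x \<in> T \<and> openin X T"
    then obtain A where "A \<in> \<N>" "x \<in> A" "A \<subseteq> T"
      using assms unfolding countable_network_def by meson
    then show "\<exists>y. y \<in> D \<and> y \<in> T"
      using h[of A] x by (intro exI[of _ "h A"]) (auto simp: D_def)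
  qed (fact x)
  then have "X closure_of D = topspace X"
    by (intro subset_antisym closure_of_subset_topspace subsetI)
  moreover have "countable D"
    unfolding D_def
    by (intro countable_image countable_Collect assms[unfolded countable_network_def, THEN conjunct1])
  moreover have "D \<subseteq> topspace X"
    unfolding D_def using h by blast
  ultimately show ?thesis unfolding separable_space_def by metis
qed

lemma k_network_imp_countable_network:
  assumes "countable \<N>" "k_network X \<N>"
  shows "countable_network X \<N>"
  unfolding countable_network_def
proof (intro conjI allI impI assms)
  fix U x assume U: "openin X U \<and> x \<in> U"
  then have "compactin X {x}" using openin_subset by auto
  then obtain \<F> where "\<F> \<subseteq> \<N>" "{x} \<subseteq> \<Union>\<F>" "\<Union>\<F> \<subseteq> U"
    using U assms(2) unfolding k_network_def by (metis empty_subsetI insert_subset)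
  then show "\<exists>A\<in>\<N>. x \<in> A \<and> A \<subseteq> U"
    by (meson UnionE Union_upper insert_subset order_trans subsetD)
qed

text \<open>Between a compact \<open>K\<close> and the preimage of an open set there is a finite
  union of k-network members, so the uncountably many conditions on compact sets can be replaced by
  conditions on finite subfamilies of two countable families.\<close>

lemma countable_network_Ck:
  assumes "countable \<N>" "k_network X \<N>" and Y: "second_countable Y"
  obtains \<S> where "countable_network (Ck X Y) \<S>"
proof -
  obtain \<B> where B: "countable \<B>" "\<And>V. V \<in> \<B> \<Longrightarrow> openin Y V"
    "\<And>U y. openin Y U \<Longrightarrow> y \<in> U \<Longrightarrow> \<exists>V\<in>\<B>. y \<in> V \<and> V \<subseteq> U"
    using Y unfolding second_countable_def by metis
  \<comment> \<open>Each pair in \<open>P\<close> is one such condition. Allowing finite sets of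
    pairs makes the family closed under finite intersections, as a subbase requires.\<close>
  define E where "E = (\<lambda>P. {f \<in> Ck_carrier X Y. \<forall>R\<in>P. f ` \<Union>(fst R) \<subseteq> \<Union>(snd R)})"
  define I where "I = {P. finite P \<and> P \<subseteq> {F. finite F \<and> F \<subseteq> \<N>} \<times> {G. finite G \<and> G \<subseteq> \<B>}}"
  have cI: "countable I"
    unfolding I_def using assms(1) B(1)
    by (intro countable_Collect_finite_subset countable_SIGMA)
  let ?S = "{{f \<in> Ck_carrier X Y. f ` K \<subseteq> U} | K U. compactin X K \<and> openin Y U}"
  have main: "\<forall>f\<in>W. \<exists>P\<in>I. f \<in> E P \<and> E P \<subseteq> W" if W: "openin (Ck X Y) W" for W
  proof -
    have "generate_topology_on ?S W"
      using W unfolding Ck_def by (rule openin_topology_generated_by)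
    then show ?thesis
    proof induction
      case Empty
      show ?case by simp
    next
      case (Int A B)
      show ?case
      proof
        fix f assume "f \<in> A \<inter> B"
        then obtain P Q where "P \<in> I" "f \<in> E P" "E P \<subseteq> A" "Q \<in> I" "f \<in> E Q" "E Q \<subseteq> B"
          using Int.IH by (metis IntE)
        moreover have "E (P \<union> Q) = E P \<inter> E Q"
          by (intro set_eqI iffI) (simp_all add: E_def ball_Un)
        moreover have "P \<union> Q \<in> I" using \<open>P \<in> I\<close> \<open>Q \<in> I\<close> by (auto simp: I_def)
        ultimately show "\<exists>P\<in>I. f \<in> E P \<and> E P \<subseteq> A \<inter> B" by blast
      qed
    next
      case (UN \<K>)
      show ?case
      proof
        fix f assume "f \<in> \<Union>\<K>"
        then obtain A where A: "A \<in> \<K>" "f \<in> A" by blast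
        then obtain P where "P \<in> I" "f \<in> E P" "E P \<subseteq> A" using UN.IH by metis
        then show "\<exists>P\<in>I. f \<in> E P \<and> E P \<subseteq> \<Union>\<K>" using A(1) by (meson Sup_upper order_trans)
      qed
    next
      case (Basis W)
      then obtain K U where W: "W = {f \<in> Ck_carrier X Y. f ` K \<subseteq> U}"
        and K: "compactin X K" and U: "openin Y U"
        by blast
      show ?case
      proof
        fix f assume f: "f \<in> W"
        then have fc: "f \<in> Ck_carrier X Y" "continuous_map X Y f" "f ` K \<subseteq> U"
          by (auto simp: W Ck_carrier_def)
        \<comment> \<open>Compactness of the image shrinks the arbitrary \<open>U\<close> to a
          finite union of base members, leaving only countably many targets.\<close>
        have "compactin Y (f ` K)" using K fc(2) by (rule image_compactin)
        moreover have "\<forall>V\<in>{V\<in>\<B>. V \<subseteq> U}. openin Y V" "f ` K \<subseteq> \<Union>{V\<in>\<B>. V \<subseteq> U}"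
          using B(2,3) U fc(3) by blast+
        ultimately obtain G where G: "finite G" "G \<subseteq> {V\<in>\<B>. V \<subseteq> U}" "f ` K \<subseteq> \<Union>G"
          unfolding compactin_def by meson
        have oG: "openin Y (\<Union>G)" using G(2) B(2) by blast
        have "openin X {x \<in> topspace X. f x \<in> \<Union>G}"
          using fc(2) oG by (rule openin_continuous_map_preimage)
        moreover have "K \<subseteq> {x \<in> topspace X. f x \<in> \<Union>G}"
          using compactin_subset_topspace[OF K] G(3) by blast
        ultimately obtain F where F: "finite F" "F \<subseteq> \<N>" "K \<subseteq> \<Union>F"
          "\<Union>F \<subseteq> {x \<in> topspace X. f x \<in> \<Union>G}"
          using assms(2) K unfolding k_network_def by meson
        have "{(F,G)} \<in> I" using F G by (auto simp: I_def)
        moreover have "f \<in> E {(F,G)}" using F(4) fc(1) by (auto simp: E_def)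
        moreover have "E {(F,G)} \<subseteq> W"
        proof
          fix h assume "h \<in> E {(F,G)}"
          then have h: "h \<in> Ck_carrier X Y" "h ` \<Union>F \<subseteq> \<Union>G" by (simp_all add: E_def)
          have "h ` K \<subseteq> h ` \<Union>F" using F(3) by (rule image_mono)
          also note h(2)
          also have "\<Union>G \<subseteq> U" using G(2) by blast
          finally show "h \<in> W" using h(1) by (simp add: W)
        qed
        ultimately show "\<exists>P\<in>I. f \<in> E P \<and> E P \<subseteq> W" by blast
      qed
    qed
  qed
  have "countable_network (Ck X Y) (E ` I)"
    unfolding countable_network_def using cI main by simp
  then show ?thesis by (rule that)
qed

section \<open>Compact-covering images\<close>

text \<open>Regularity puts \<open>K\<close> in an open \<open>V\<close> separated from the
  complement of \<open>U\<close>; closures of network members inside \<open>V\<close> then stay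
  inside \<open>U\<close>. The family is indexed by naturals so that points can be coded by
  sequences.\<close>

lemma closed_k_network_sequence:
  assumes X: "regular_space X" and N: "countable \<N>" "k_network X \<N>"
  obtains g :: "nat \<Rightarrow> 'a set" where "\<And>n. closedin X (g n)"
    "\<And>U K. openin X U \<Longrightarrow> compactin X K \<Longrightarrow> K \<subseteq> U \<Longrightarrow>
       \<exists>F. finite F \<and> K \<subseteq> \<Union>(g ` F) \<and> \<Union>(g ` F) \<subseteq> U"
proof -
  \<comment> \<open>Adding the empty set guarantees a nonempty family, so that the enumeration has
    exactly this range.\<close>
  define e where "e = from_nat_into (insert {} \<N>)"
  have e: "range e = insert {} \<N>"
    unfolding e_def using N(1) by (intro range_from_nat_into) auto
  show ?thesis
  proof (rule that[of "\<lambda>n. X closure_of e n"])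
    fix U K assume U: "openin X U" and K: "compactin X K" and KU: "K \<subseteq> U"
    have "closedin X (topspace X - U)" "disjnt K (topspace X - U)"
      using U KU by (auto simp: disjnt_def)
    then obtain V V' where V: "openin X V" "openin X V'" "K \<subseteq> V"
      "topspace X - U \<subseteq> V'" "disjnt V V'"
      by (metis K X regular_space_compact_closed_separation)
    obtain \<F> where F: "finite \<F>" "\<F> \<subseteq> \<N>" "K \<subseteq> \<Union>\<F>" "\<Union>\<F> \<subseteq> V"
      using N(2) V(1,3) K unfolding k_network_def by meson
    have "\<F> \<subseteq> range e" using F(2) e by blast
    then obtain F where F': "finite F" "\<F> = e ` F"
      using F(1) by (meson finite_subset_image subset_UNIV)
    have "K \<subseteq> (\<Union>n\<in>F. X closure_of e n)"
    proof
      fix x assume x: "x \<in> K"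
      then obtain n where n: "n \<in> F" "x \<in> e n" using F(3) F'(2) by blast
      then have "x \<in> X closure_of e n"
        using x compactin_subset_topspace[OF K] by (auto simp: in_closure_of)
      then show "x \<in> (\<Union>n\<in>F. X closure_of e n)" using n(1) by blast
    qed
    moreover have "X closure_of e n \<subseteq> U" if "n \<in> F" for n
    proof -
      have "e n \<subseteq> topspace X - V'"
        using that F(4) F'(2) V(5) openin_subset[OF V(1)] by (auto simp: disjnt_def)
      then have "X closure_of e n \<subseteq> topspace X - V'"
        using V(2) by (intro closure_of_minimal) auto
      then show ?thesis using V(4) by blast
    qed
    ultimately show "\<exists>F. finite F \<and> K \<subseteq> (\<Union>n\<in>F. X closure_of e n) \<and> (\<Union>n\<in>F. X closure_of e n) \<subseteq> U"
      using F'(1) by blast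
  qed simp
qed

text \<open>A sequence of indices is sent to the point at which the chosen closed sets form a
  network; the T1 property makes this point unique. The lift of a compact \<open>K\<close> is the
  projection of a closed incidence relation in the product of \<open>K\<close> with a compact set of
  sequences.\<close>

lemma k_network_imp_compact_covering_image:
  assumes X: "regular_T1_space X" and N: "countable \<N>" "k_network X \<N>"
  obtains M :: "(nat \<Rightarrow> nat) set" and p where
    "continuous_map (top_of_set M) X p"
    "\<And>K. compactin X K \<Longrightarrow> \<exists>L. compactin (top_of_set M) L \<and> p ` L = K"
proof -
  have reg: "regular_space X" and t1: "t1_space X"
    using X by (auto simp: regular_T1_space_def)
  obtain g :: "nat \<Rightarrow> 'a set" where closed: "\<And>n. closedin X (g n)" and
    net: "\<And>U K. openin X U \<Longrightarrow> compactin X K \<Longrightarrow> K \<subseteq> U \<Longrightarrow>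
       \<exists>F. finite F \<and> K \<subseteq> \<Union>(g ` F) \<and> \<Union>(g ` F) \<subseteq> U"
    using closed_k_network_sequence[OF reg N] by blast
  text \<open>A compact set \<open>K\<close> is covered by the codes that pick an index from each of the countably many
    finite covers of \<open>K\<close>: such a code is a network at any common point of its sets in \<open>K\<close>.\<close>
  define codes where "codes = (\<lambda>s x. x \<in> topspace X \<and> (\<forall>i. x \<in> g (s i)) \<and>
    (\<forall>U. openin X U \<and> x \<in> U \<longrightarrow> (\<exists>i::nat. g (s i) \<subseteq> U)))"
  define M where "M = {s. \<exists>x. codes s x}"
  define p where "p = (\<lambda>s. SOME x. codes s x)"
  have openin_minus: "openin X (topspace X - {x})" if "x \<in> topspace X" for x
    using t1 that by (simp add: openin_diff t1_space_closedin_singleton)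
  have unique: "x = y" if xy: "codes s x" "codes s y" for s x y
  proof (rule ccontr)
    assume "x \<noteq> y"
    then have "x \<in> topspace X - {y}" using xy by (auto simp: codes_def)
    then obtain i where "g (s i) \<subseteq> topspace X - {y}"
      using openin_minus[of y] xy unfolding codes_def by meson
    then show False using xy(2) by (auto simp: codes_def)
  qed
  have p: "p s = x" if "codes s x" for s x
    unfolding p_def by (rule some_equality[of "codes s", OF that]) (rule unique[OF _ that])
  have codes_p: "codes s (p s)" if "s \<in> M" for s
    using that p by (auto simp: M_def)
  have p_in_g: "p s \<in> g (s i)" if "s \<in> M" for s i
    using codes_p[OF that] unfolding codes_def by blast
  have p_network: "\<exists>i. g (s i) \<subseteq> U" if "s \<in> M" "openin X U" "p s \<in> U" for s U
    using codes_p[OF that(1)] that(2,3) unfolding codes_def by blast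
  have open_coord: "open {s :: nat \<Rightarrow> nat. s i = n}" for i n
  proof -
    have "continuous_on UNIV (\<lambda>s :: nat \<Rightarrow> nat. s i)" by (rule continuous_on_product_coordinates)
    then have "open ((\<lambda>s :: nat \<Rightarrow> nat. s i) -` {n})"
      by (rule open_vimage[OF open_discrete])
    then show ?thesis by (simp add: vimage_def)
  qed
  have cont: "continuous_map (top_of_set M) X p"
    unfolding continuous_map
  proof (intro conjI allI impI)
    show "p ` topspace (top_of_set M) \<subseteq> topspace X"
      using p_in_g closedin_subset[OF closed] by fastforce
    fix U assume U: "openin X U"
    show "openin (top_of_set M) {s \<in> topspace (top_of_set M). p s \<in> U}"
    proof (subst openin_subopen, intro ballI)
      fix s assume s: "s \<in> {s \<in> topspace (top_of_set M). p s \<in> U}"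
      then obtain i where i: "g (s i) \<subseteq> U"
        using p_network[of s U] U by auto
      \<comment> \<open>Agreement in the single coordinate \<open>i\<close> is an open condition,
        and it already confines \<open>p t\<close> to \<open>g (s i)\<close>, a subset of
        \<open>U\<close>.\<close>
      have "openin (top_of_set M) (M \<inter> {t. t i = s i})"
        using open_coord by (simp add: openin_open_Int)
      moreover have "M \<inter> {t. t i = s i} \<subseteq> {s \<in> topspace (top_of_set M). p s \<in> U}"
      proof
        fix t assume t: "t \<in> M \<inter> {t. t i = s i}"
        then have "p t \<in> g (t i)" using p_in_g by blast
        then show "t \<in> {s \<in> topspace (top_of_set M). p s \<in> U}" using t i by auto
      qed
      ultimately show "\<exists>T. openin (top_of_set M) T \<and> s \<in> T \<and> T \<subseteq> {s \<in> topspace (top_of_set M). p s \<in> U}"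
        using s by (intro exI[of _ "M \<inter> {t. t i = s i}"]) auto
    qed
  qed
  show ?thesis
  proof (rule that[OF cont])
    fix K assume K: "compactin X K"
    have KX: "K \<subseteq> topspace X" using K by (rule compactin_subset_topspace)
    define \<C> where "\<C> = {F :: nat set. finite F \<and> K \<subseteq> \<Union>(g ` F)}"
    have cC: "countable \<C>"
      by (rule countable_subset[OF _ countable_Collect_finite]) (auto simp: \<C>_def)
    have "\<C> \<noteq> {}" using net[OF openin_topspace K KX] by (auto simp: \<C>_def)
    define G where "G = from_nat_into \<C>"
    have G: "range G = \<C>" unfolding G_def using cC \<open>\<C> \<noteq> {}\<close> by (rule range_from_nat_into[rotated])
    have Gi: "finite (G i)" "K \<subseteq> \<Union>(g ` G i)" for i
      using G by (auto simp: \<C>_def)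
    \<comment> \<open>\<open>P\<close> is compact as a product of finite sets. \<open>R\<close>
      pairs a sequence with each point of \<open>K\<close> lying in all the sets it selects.\<close>
    define P where "P = PiE UNIV G"
    define R where "R = {(s, x). s \<in> P \<and> x \<in> K \<and> (\<forall>i. x \<in> g (s i))}"
    have codes: "codes s x" if sx: "(s, x) \<in> R" for s x
      unfolding codes_def
    proof (intro conjI allI impI)
      show x: "x \<in> topspace X" and "x \<in> g (s i)" for i
        using sx KX by (auto simp: R_def)
      fix U assume U: "openin X U \<and> x \<in> U"
      have "neighbourhood_base_of (closedin X) X"
        using reg by (simp add: neighbourhood_base_of_closedin)
      then obtain V C where V: "openin X V" "closedin X C" "x \<in> V" "V \<subseteq> C" "C \<subseteq> U"
        using U unfolding neighbourhood_base_of by meson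
      \<comment> \<open>The part of \<open>K\<close> in \<open>C\<close> is covered inside
        \<open>U\<close> by \<open>F1\<close>, and the part outside \<open>V\<close> is covered away
        from \<open>x\<close> by \<open>F2\<close>. Their union covers \<open>K\<close> and so
        occurs as some \<open>G i\<close>; since \<open>x\<close> lies in \<open>g (s i)\<close>,
        the index \<open>s i\<close> must come from \<open>F1\<close>.\<close>
      have "compactin X (C \<inter> K)" using V(2) K by (rule closed_Int_compactin)
      then obtain F1 where F1: "finite F1" "C \<inter> K \<subseteq> \<Union>(g ` F1)" "\<Union>(g ` F1) \<subseteq> U"
        using net[of U "C \<inter> K"] U V(5) by blast
      have "compactin X ((topspace X - V) \<inter> K)"
        using V(1) K by (intro closed_Int_compactin) auto
      then obtain F2 where F2: "finite F2" "(topspace X - V) \<inter> K \<subseteq> \<Union>(g ` F2)"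
        "\<Union>(g ` F2) \<subseteq> topspace X - {x}"
        using net[OF openin_minus[OF x], of "(topspace X - V) \<inter> K"] V(3) by blast
      have "K \<subseteq> \<Union>(g ` (F1 \<union> F2))"
        using F1(2) F2(2) V(4) KX by blast
      then have "F1 \<union> F2 \<in> \<C>" using F1(1) F2(1) by (simp add: \<C>_def)
      then obtain i where i: "G i = F1 \<union> F2" using G by (metis rangeE)
      have "s i \<in> F1 \<union> F2" using sx i by (auto simp: R_def P_def)
      moreover have "s i \<notin> F2" using sx F2(3) by (auto simp: R_def)
      ultimately have "g (s i) \<subseteq> U" using F1(3) by blast
      then show "\<exists>i. g (s i) \<subseteq> U" by blast
    qed
    have "compactin euclidean P"
      unfolding P_def euclidean_product_topology[symmetric] compactin_PiE
      by (simp add: Gi(1) finite_imp_compact)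
    then have PK: "compactin (prod_topology euclidean X) (P \<times> K)"
      using K by (simp add: compactin_Times)
    \<comment> \<open>Closedness of every \<open>g n\<close> is used here: the complement is a union
      of open boxes, one for each value of coordinate \<open>i\<close>.\<close>
    have cl: "closedin (prod_topology euclidean X) {(s :: nat \<Rightarrow> nat, x). x \<in> g (s i)}" for i
    proof -
      have "topspace (prod_topology euclidean X) - {(s :: nat \<Rightarrow> nat, x). x \<in> g (s i)}
          = (\<Union>n. {s :: nat \<Rightarrow> nat. s i = n} \<times> (topspace X - g n))"
        by auto
      moreover have "openin (prod_topology euclidean X) \<dots>"
        using open_coord openin_diff[OF openin_topspace closed]
        by (intro openin_Union ballI) (auto simp: openin_prod_Times_iff)
      moreover have "{(s :: nat \<Rightarrow> nat, x). x \<in> g (s i)} \<subseteq> topspace (prod_topology euclidean X)"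
        using closed closedin_subset by fastforce
      ultimately show ?thesis by (simp add: closedin_def)
    qed
    have "R = (\<Inter>i. {(s :: nat \<Rightarrow> nat, x). x \<in> g (s i)}) \<inter> (P \<times> K)"
      by (auto simp: R_def)
    moreover have "closedin (prod_topology euclidean X) (\<Inter>i. {(s :: nat \<Rightarrow> nat, x). x \<in> g (s i)})"
      by (intro closedin_INT cl) simp
    ultimately have "compactin (prod_topology euclidean X) R"
      using PK closed_Int_compactin by metis
    then have "compactin euclidean (fst ` R)"
      using continuous_map_fst by (rule image_compactin)
    moreover have "fst ` R \<subseteq> M"
      unfolding M_def using codes by (metis (mono_tags) image_subsetI mem_Collect_eq prod.collapse)
    ultimately have "compactin (top_of_set M) (fst ` R)"
      by (simp add: compactin_subtopology)
    moreover have "p ` fst ` R = K"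
    proof -
      have "p (fst z) = snd z" if "z \<in> R" for z
        using p[OF codes[of "fst z" "snd z"]] that by simp
      then have "p ` fst ` R = snd ` R"
        by (simp add: image_image)
      also have "\<dots> = K"
      proof
        show "snd ` R \<subseteq> K" by (auto simp: R_def)
        show "K \<subseteq> snd ` R"
        proof
          fix x assume x: "x \<in> K"
          \<comment> \<open>Every \<open>G i\<close> covers \<open>K\<close>, so each point of
            \<open>K\<close> admits a choice from every cover.\<close>
          then have "\<exists>n. n \<in> G i \<and> x \<in> g n" for i using Gi(2)[of i] by blast
          then obtain s where "\<And>i. s i \<in> G i \<and> x \<in> g (s i)" by metis
          then have "(s, x) \<in> R" using x by (auto simp: R_def P_def)
          then show "x \<in> snd ` R" by force
        qed
      qed
      finally show ?thesis .
    qed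
    ultimately show "\<exists>L. compactin (top_of_set M) L \<and> p ` L = K" by blast
  qed
qed

section \<open>Copies over the universe type\<close>

text \<open>The topology is transported along an injection into \<open>'u\<close> by pulling it back
  through the inverse.\<close>

lemma homeomorphic_copy_exists:
  fixes T :: "'a topology"
  assumes "topspace T \<lesssim> (UNIV :: 'u set)"
  obtains Z :: "'u topology" where "T homeomorphic_space Z"
proof -
  obtain e :: "'a \<Rightarrow> 'u" where e: "inj_on e (topspace T)"
    using assms by (auto simp: lepoll_def)
  let ?d = "inv_into (topspace T) e"
  let ?Z = "pullback_topology (e ` topspace T) ?d T"
  have "homeomorphic_maps T ?Z e ?d"
    unfolding homeomorphic_maps_def
  proof (intro conjI ballI)
    show "continuous_map T ?Z e"
    proof (rule continuous_map_pullback')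
      show "continuous_map T T (?d \<circ> e)"
        by (rule continuous_map_eq[of T T id]) (use e in auto)
    qed auto
    show "continuous_map ?Z T ?d"
      using continuous_map_pullback[OF continuous_map_id, of "e ` topspace T" ?d T] by simp
  qed (use e in \<open>auto simp: topspace_pullback_topology\<close>)
  then show ?thesis
    using that homeomorphic_maps_imp_homeomorphic_space by blast
qed

text \<open>A continuous real function is determined by its values on a countable dense set, and
  each value by the rationals above it. Functions thus inject into the subsets of a countable
  set.\<close>

lemma Ck_carrier_lepoll_real:
  assumes "separable_space X"
  shows "Ck_carrier X euclideanreal \<lesssim> (UNIV :: real set)"
proof -
  obtain D where D: "countable D" "D \<subseteq> topspace X" "X closure_of D = topspace X"
    using assms by (auto simp: separable_space_def)
  let ?E = "D \<times> (\<rat> :: real set)"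
  define c where "c = (\<lambda>f :: 'a \<Rightarrow> real. {(d, q). d \<in> D \<and> q \<in> \<rat> \<and> f d < q})"
  have "inj_on c (Ck_carrier X euclideanreal)"
  proof (rule inj_onI)
    fix f h assume fh: "f \<in> Ck_carrier X euclideanreal" "h \<in> Ck_carrier X euclideanreal" "c f = c h"
    have lt: "f d < q \<longleftrightarrow> h d < q" if "d \<in> D" "q \<in> \<rat>" for d q
      using that fh(3) unfolding c_def set_eq_iff by force
    have eqD: "f d = h d" if "d \<in> D" for d
      using lt[OF that] Rats_dense_in_real
      by (metis linorder_neqE_linordered_idom less_asym)
    show "f = h"
    proof (rule extensionalityI[of _ "topspace X"])
      fix x assume "x \<in> topspace X"
      then have "x \<in> X closure_of D" using D(3) by simp
      then show "f x = h x"
        using forall_in_closure_of_eq[of x X D euclideanreal f h] fh eqD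
        by (auto simp: Ck_carrier_def)
    qed (use fh in \<open>auto simp: Ck_carrier_def\<close>)
  qed
  moreover have "c ` Ck_carrier X euclideanreal \<subseteq> Pow ?E"
    by (auto simp: c_def)
  ultimately have "Ck_carrier X euclideanreal \<lesssim> Pow ?E"
    unfolding lepoll_def by blast
  also have "Pow ?E \<lesssim> (UNIV :: nat set set)"
  proof -
    have "countable ?E" using D(1) countable_rat by blast
    then obtain k :: "_ \<Rightarrow> nat" where "inj_on k ?E" by blast
    then have "inj_on (image k) (Pow ?E)" by (rule inj_on_image_Pow)
    then show ?thesis unfolding lepoll_def by blast
  qed
  also have "(UNIV :: nat set set) \<lesssim> (UNIV :: real set)"
    using nat_sets_eqpoll_reals by (rule eqpoll_imp_lepoll)
  finally show ?thesis .
qed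

definition has_copy_in :: "'u topology set \<Rightarrow> 'a topology \<Rightarrow> bool" where
  "has_copy_in \<X> T \<longleftrightarrow> (\<exists>Z\<in>\<X>. T homeomorphic_space Z)"

lemma has_copy_in_homeomorphic:
  "has_copy_in \<X> T \<Longrightarrow> T' homeomorphic_space T \<Longrightarrow> has_copy_in \<X> T'"
  unfolding has_copy_in_def by (meson homeomorphic_space_trans)

lemma has_copy_in_subtopology:
  assumes \<X>: "Ck_stable_class \<X>" and T: "has_copy_in \<X> T" and S: "S \<subseteq> topspace T"
  shows "has_copy_in \<X> (subtopology T S)"
proof -
  obtain Z where Z: "Z \<in> \<X>" "T homeomorphic_space Z"
    using T by (auto simp: has_copy_in_def)
  then obtain f where f: "homeomorphic_map T Z f"
    by (auto simp: homeomorphic_space)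
  have fS: "f ` S \<subseteq> topspace Z"
    using homeomorphic_imp_surjective_map[OF f] S by blast
  have "topspace T \<inter> S = S" "topspace Z \<inter> f ` S = f ` S" using S fS by auto
  then have "homeomorphic_map (subtopology T S) (subtopology Z (f ` S)) f"
    using homeomorphic_map_subtopologies[OF f, of S "f ` S"] by simp
  then show ?thesis
    using Ck_stable_classD(2)[OF \<X> Z(1) fS] homeomorphic_map_imp_homeomorphic_space
    unfolding has_copy_in_def by blast
qed

text \<open>The closure clause is applied to copies of \<open>S\<close> and \<open>T\<close>, whose
  function space is homeomorphic to \<open>Ck S T\<close>. The cardinality bound supplies the copy
  of that space over \<open>'u\<close> which the clause then puts into the class.\<close>

lemma has_copy_in_Ck:
  fixes \<X> :: "'u topology set"
  assumes \<X>: "Ck_stable_class \<X>" and "has_copy_in \<X> S" "has_copy_in \<X> T"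
    and "Lindelof_space S" and "Ck_carrier S T \<lesssim> (UNIV :: 'u set)"
  shows "has_copy_in \<X> (Ck S T)"
proof -
  obtain A B where AB: "A \<in> \<X>" "S homeomorphic_space A" "B \<in> \<X>" "T homeomorphic_space B"
    using assms by (auto simp: has_copy_in_def)
  obtain Z :: "'u topology" where Z: "Ck S T homeomorphic_space Z"
    using homeomorphic_copy_exists[of "Ck S T"] assms(5) by auto
  have "Lindelof_space A"
    using AB(2) assms(4) Lindelof_space_quotient_map_image
    by (metis homeomorphic_map_def homeomorphic_space)
  moreover have "Ck A B homeomorphic_space Z"
    using homeomorphic_space_Ck[OF AB(2,4)] Z
    by (meson homeomorphic_space_sym homeomorphic_space_trans)
  ultimately have "Z \<in> \<X>"
    using Ck_stable_classD(6)[OF \<X> AB(1,3)] by blast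
  then show ?thesis using Z by (auto simp: has_copy_in_def)
qed

lemma has_copy_in_separable_metrizable:
  fixes \<X> :: "'u topology set"
  assumes "separable_metrizable_class \<subseteq> \<X>"
    and "separable_space T" "metrizable_space T" "topspace T \<lesssim> (UNIV :: 'u set)"
  shows "has_copy_in \<X> T"
proof -
  obtain Z :: "'u topology" where Z: "T homeomorphic_space Z"
    using homeomorphic_copy_exists[OF assms(4)] .
  then have "Z \<in> separable_metrizable_class"
    using assms(2,3) homeomorphic_separable_space homeomorphic_metrizable_space
    by (auto simp: separable_metrizable_class_def)
  then show ?thesis using assms(1) Z by (auto simp: has_copy_in_def)
qed

lemma second_countable_euclidean:
  "second_countable (euclidean :: 'a::second_countable_topology topology)"
proof -
  obtain \<B> :: "'a set set" where "countable \<B>" "topological_basis \<B>"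
    using ex_countable_basis by blast
  then show ?thesis
    unfolding second_countable_def by (metis open_openin topological_basisE topological_basis_open)
qed

text \<open>A sequence is determined by its graph, which a pairing function encodes as a set of
  naturals.\<close>

lemma sequences_lepoll_real: "(M :: (nat \<Rightarrow> nat) set) \<lesssim> (UNIV :: real set)"
proof -
  have "inj (\<lambda>s :: nat \<Rightarrow> nat. prod_encode ` (range (\<lambda>n. (n, s n))))"
  proof (rule injI)
    fix s t :: "nat \<Rightarrow> nat"
    assume "prod_encode ` range (\<lambda>n. (n, s n)) = prod_encode ` range (\<lambda>n. (n, t n))"
    then have "range (\<lambda>n. (n, s n)) = range (\<lambda>n. (n, t n))"
      by (simp only: inj_image_eq_iff[OF inj_prod_encode])
    then show "s = t" by (auto simp: set_eq_iff image_iff)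
  qed
  then have "M \<lesssim> (UNIV :: nat set set)"
    unfolding lepoll_def using inj_on_subset by blast
  then show ?thesis
    using nat_sets_eqpoll_reals by (metis lepoll_trans2)
qed

theorem theorem1p8:
  fixes X :: "'u topology"
  assumes "(UNIV :: real set) \<lesssim> (UNIV :: 'u set)"
    and "Ascoli_space X" and "aleph0_space X"
  shows "X \<in> Ck_closure (separable_metrizable_class :: 'u topology set)"
proof -
  let ?\<X> = "Ck_closure (separable_metrizable_class :: 'u topology set)"
  let ?F = "Ck X euclideanreal"
  note \<X> = Ck_closure_smallest(1,2)[OF separable_metrizable_regular_T1, where 'a = 'u]
  obtain \<N> where reg: "regular_T1_space X" and N: "countable \<N>" "k_network X \<N>"
    using assms(3) by (auto simp: aleph0_space_def)
  obtain M :: "(nat \<Rightarrow> nat) set" and p where p: "continuous_map (top_of_set M) X p"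
    "\<And>K. compactin X K \<Longrightarrow> \<exists>L. compactin (top_of_set M) L \<and> p ` L = K"
    using k_network_imp_compact_covering_image[OF reg N] by metis
  obtain S where S: "S \<subseteq> topspace (Ck (top_of_set M) euclideanreal)"
    "?F homeomorphic_space subtopology (Ck (top_of_set M) euclideanreal) S"
    using compact_covering_imp_Ck_embeds[OF p] by metis
  have M: "second_countable (top_of_set M)"
    by (intro second_countable_subtopology second_countable_euclidean)
  have real: "has_copy_in ?\<X> euclideanreal"
    using assms(1) \<X>(2)
    by (intro has_copy_in_separable_metrizable)
      (auto simp: second_countable_euclidean second_countable_imp_separable_space
        metrizable_space_euclidean)
  \<comment> \<open>Sequences of naturals carry the product of countably many discrete, hence
    metrizable, topologies.\<close>
  have "(euclidean :: nat topology) = discrete_topology UNIV"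
    by (simp add: topology_eq open_discrete)
  then have "metrizable_space (top_of_set M)"
    by (intro metrizable_space_subtopology)
      (simp add: euclidean_product_topology[symmetric] metrizable_space_product_topology)
  then have copyM: "has_copy_in ?\<X> (top_of_set M)"
    using M \<X>(2) lepoll_trans[OF sequences_lepoll_real assms(1)]
    by (intro has_copy_in_separable_metrizable)
      (auto simp: second_countable_imp_separable_space)
  have "Lindelof_space (top_of_set M)" "separable_space (top_of_set M)"
    using M by (simp_all add: second_countable_imp_separable_space second_countable_imp_Lindelof_space)
  then have "has_copy_in ?\<X> (Ck (top_of_set M) euclideanreal)"
    by (intro has_copy_in_Ck[OF \<X>(1) copyM real]
        lepoll_trans[OF Ck_carrier_lepoll_real assms(1)])
  then have F: "has_copy_in ?\<X> ?F"
    using has_copy_in_subtopology[OF \<X>(1) _ S(1)] S(2) has_copy_in_homeomorphic by blast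
  obtain \<S> where "countable_network ?F \<S>"
    using countable_network_Ck[OF N second_countable_euclidean] by metis
  \<comment> \<open>Lindelofness is what the closure clause asks of the domain; separability bounds
    the cardinality of the second function space.\<close>
  then have "Lindelof_space ?F" "separable_space ?F"
    by (simp_all add: countable_network_imp_Lindelof countable_network_imp_separable)
  then have FF: "has_copy_in ?\<X> (Ck ?F euclideanreal)"
    by (intro has_copy_in_Ck[OF \<X>(1) F real] lepoll_trans[OF Ck_carrier_lepoll_real assms(1)])
  have "Lindelof_space X"
    using countable_network_imp_Lindelof[OF k_network_imp_countable_network[OF N]] .
  then have "completely_regular_space X"
    using reg normal_imp_completely_regular_space regular_Lindelof_imp_normal_space
    unfolding regular_T1_space_def by blast
  then obtain S' where "S' \<subseteq> topspace (Ck ?F euclideanreal)"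
    "X homeomorphic_space subtopology (Ck ?F euclideanreal) S'"
    using Ascoli_embeds_bidual[OF _ assms(2)] by metis
  then have "has_copy_in ?\<X> X"
    using has_copy_in_subtopology[OF \<X>(1) FF] has_copy_in_homeomorphic by blast
  then obtain Z where "Z \<in> ?\<X>" "X homeomorphic_space Z"
    by (auto simp: has_copy_in_def)
  then show ?thesis
    using Ck_stable_classD(3)[OF \<X>(1)] homeomorphic_space_sym by blast
qed

end
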